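(* Let $f\colon \mathbb{R}^n \to \mathbb{R}$ be $C^2$ and $\rho$-weakly convex with $\rho\geq 0$. Assume that $\nabla^2 f$ is globally Lipschitz: there exists $L\geq 0$ such that $$ \Vert \nabla^2 f(u)-\nabla^2 f(v)\Vert \leq L\Vert u-v\Vert \quad \text{for all } u,v\in \mathbb{R}^n. $$ Fix $x\in \mathbb{R}^n$ and $0<\lambda <1/\rho$, and set $\mu:=\frac{1}{\lambda}-\rho>0$. Then, for every $\delta>0$, $$ \Vert m_{\delta}(x)-\operatorname{prox}_{\lambda f}(x)\Vert \leq \frac{nL}{\mu^2}\,\delta. $$
   Context: $\mathbb{R}^n$ carries its Euclidean inner product and norm $\|\cdot\|$; for matrices $\|\cdot\|$ is the induced ($\ell_2$-)operator norm. Convention: $1/0=+\infty$. The function $f$ is $\rho$-weakly convex ($\rho\ge 0$) if $f+\frac{\rho}{2}\|\cdot\|^2$ is convex. For $0<\lambda<1/\rho$, $\operatorname{prox}_{\lambda f}(x)$ denotes the unique minimizer over $y\in\mathbb{R}^n$ of $y\mapsto f(y)+\frac{1}{2\lambda}\|x-y\|^2$. For $\delta>0$, $$ m_{\delta}(x):=\frac{\mathbb{E}_{y\sim \mathcal{N}(x,\delta \lambda I)}\bigl[y\, \exp(-f(y)/\delta)\bigr]}{\mathbb{E}_{y\sim \mathcal{N}(x,\delta \lambda I)}\bigl[\exp(-f(y)/\delta)\bigr]} =\frac{\int_{\mathbb{R}^n} y\,e^{-g(y)/\delta}\,dy}{\int_{\mathbb{R}^n} e^{-g(y)/\delta}\,dy},\qquad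 g(y):=f(y)+\frac{1}{2\lambda}\|x-y\|^2, $$ where $\mathcal{N}(x,\delta\lambda I)$ is the Gaussian distribution on $\mathbb{R}^n$ with mean $x$ and covariance $\delta\lambda I$. *)

theory Defs
  imports "HOL-Probability.Probability"
begin

definition grad :: "(real ^ 'n \<Rightarrow> real) \<Rightarrow> real ^ 'n \<Rightarrow> real ^ 'n" where
  "grad f x = (THE g. GDERIV f x :> g)"

definition hessian :: "(real ^ 'n \<Rightarrow> real) \<Rightarrow> real ^ 'n \<Rightarrow> real ^ 'n ^ 'n" where
  "hessian f x = jacobian (grad f) (at x)"

definition twice_cont_diff :: "(real ^ 'n \<Rightarrow> real) \<Rightarrow> bool" where
  "twice_cont_diff f \<longleftrightarrow>
     f differentiable_on UNIV \<and> grad f differentiable_on UNIV \<and> continuous_on UNIV (hessian f)"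

(* The norm of type real ^ 'n ^ 'm is the Frobenius norm, so the l2-operator norm is
   taken of the linear map that the matrix induces. *)
definition op_norm :: "real ^ 'n ^ 'm \<Rightarrow> real" where
  "op_norm A = onorm (\<lambda>h. A *v h)"

definition weakly_convex :: "real \<Rightarrow> (real ^ 'n \<Rightarrow> real) \<Rightarrow> bool" where
  "weakly_convex \<rho> f \<longleftrightarrow> convex_on UNIV (\<lambda>x. f x + \<rho> / 2 * (norm x)\<^sup>2)"

(* A definite description, hence only meaningful when the minimizer exists and is unique;
   this is the case for rho-weakly convex f and lam > 0 with lam * rho < 1. *)
definition prox :: "real \<Rightarrow> (real ^ 'n \<Rightarrow> real) \<Rightarrow> real ^ 'n \<Rightarrow> real ^ 'n" where
  "prox lam f x =
     (THE y. is_arg_min (\<lambda>y. f y + 1 / (2 * lam) * (norm (x - y))\<^sup>2) (\<lambda>_. True) y)"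

(* The Gaussian distribution with mean x and covariance matrix v * I (v > 0): independent
   coordinates of variance v. The second argument of normal_density is the standard deviation. *)
definition gaussian :: "real ^ 'n \<Rightarrow> real \<Rightarrow> (real ^ 'n) measure" where
  "gaussian x v =
     density lborel (\<lambda>y. ennreal (\<Prod>i\<in>UNIV. normal_density (x $ i) (sqrt v) (y $ i)))"

definition gibbs_mean ::
    "real \<Rightarrow> (real ^ 'n \<Rightarrow> real) \<Rightarrow> real \<Rightarrow> real ^ 'n \<Rightarrow> real ^ 'n" where
  "gibbs_mean lam f \<delta> x =
     (\<integral>y. exp (- f y / \<delta>) *\<^sub>R y \<partial>gaussian x (\<delta> * lam)) /\<^sub>R
     (\<integral>y. exp (- f y / \<delta>) \<partial>gaussian x (\<delta> * lam))"

end

theory Submission imports Defs begin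

text \<open>
  Put \<open>U = g / \<delta>\<close>, which is \<open>\<kappa>\<close>-strongly convex with \<open>\<kappa> = \<mu> / \<delta>\<close> and has an \<open>M\<close>-Lipschitz
  Hessian with \<open>M = L / \<delta>\<close>, let \<open>p\<close> be its minimizer, \<open>A\<close> the Hessian at \<open>p\<close>, and let \<open>Y\<close> have
  density proportional to \<open>exp (- U)\<close>. Integration by parts gives \<open>E \<langle>Y - p, \<nabla>U(Y)\<rangle> = n\<close>, hence
  \<open>E |Y - p|\<^sup>2 \<le> n / \<kappa>\<close> by strong convexity, and \<open>E \<nabla>U(Y) = 0\<close>. As \<open>\<nabla>U(y)\<close> differs from
  \<open>A (y - p)\<close> by at most \<open>M |y - p|\<^sup>2\<close>, the latter yields \<open>|A (E Y - p)| \<le> M n / \<kappa>\<close>, so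
  \<open>|E Y - p| \<le> n M / \<kappa>\<^sup>2 = n L \<delta> / \<mu>\<^sup>2\<close>. Both integrations by parts are avoided by comparing
  \<open>\<integral> exp (- U)\<close> with itself under a dilation about \<open>p\<close> and under a translation, where convexity
  bounds the change of \<open>U\<close> and \<open>exp t \<ge> 1 + t\<close> linearizes.
\<close>

section \<open>Affine changes of variables and Gaussian integrability\<close>

lemma lborel_integral_affine:
  fixes h :: "'a::euclidean_space \<Rightarrow> real" and t :: 'a
  assumes "h \<in> borel_measurable borel" and "c \<noteq> 0"
  shows "(\<integral>y. h y \<partial>lborel) = \<bar>c\<bar> ^ DIM('a) * (\<integral>y. h (t + c *\<^sub>R y) \<partial>lborel)"
proof -
  \<comment> \<open>Lebesgue measure is its own affine image, weighted by |c|^n in dimension n.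
    Below, \<open>c\<close> is a dilation factor about \<open>p\<close>, or \<open>1\<close> for a
    translation.\<close>
  have "(\<integral>y. h y \<partial>lborel) =
      (\<integral>y. h y \<partial>density (distr lborel borel (\<lambda>x. t + c *\<^sub>R x)) (\<lambda>_. \<bar>c\<bar> ^ DIM('a)))"
    using lborel_affine[OF \<open>c \<noteq> 0\<close>, of t] by simp
  also have "\<dots> = \<bar>c\<bar> ^ DIM('a) * (\<integral>y. h (t + c *\<^sub>R y) \<partial>lborel)"
    using assms by (subst integral_density) (simp_all add: integral_distr)
  finally show ?thesis .
qed

lemma lborel_integrable_affine:
  fixes h :: "'a::euclidean_space \<Rightarrow> real" and t :: 'a
  assumes "integrable lborel h" and "c \<noteq> 0"
  shows "integrable lborel (\<lambda>y. h (t + c *\<^sub>R y))"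
proof -
  have "integrable (density (distr lborel borel (\<lambda>x. t + c *\<^sub>R x)) (\<lambda>_. \<bar>c\<bar> ^ DIM('a))) h"
    using assms lborel_affine[OF \<open>c \<noteq> 0\<close>, of t] by simp
  then show ?thesis
    using assms borel_measurable_integrable[OF assms(1)]
    by (subst (asm) integrable_density) (simp_all add: integrable_distr_eq)
qed

text \<open>The integrand factorizes over coordinates, and each factor is a multiple of the centred
  normal density whose variance \<open>1 / (2 * a)\<close> matches the exponent.\<close>

lemma integrable_exp_neg_norm_squared:
  assumes "a > 0"
  shows "integrable lborel (\<lambda>y::'a::euclidean_space. exp (- a * (norm y)\<^sup>2))"
proof -
  define \<sigma> where "\<sigma> = sqrt (1 / (2 * a))"
  have \<sigma>: "\<sigma> > 0" "\<sigma>\<^sup>2 = 1 / (2 * a)"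
    using assms by (simp_all add: \<sigma>_def)
  have "(\<integral>\<^sup>+t. ennreal (exp (- a * t\<^sup>2)) \<partial>lborel) < \<infinity>"
  proof -
    have eq: "exp (- a * t\<^sup>2) = sqrt (2 * pi * \<sigma>\<^sup>2) * normal_density 0 \<sigma> t" for t
      using \<sigma> assms by (simp add: normal_density_def field_simps)
    have "integrable lborel (\<lambda>t. exp (- a * t\<^sup>2))"
      unfolding eq using \<sigma> by simp
    then show ?thesis
      by (simp add: integrable_iff_bounded)
  qed
  then have "(\<Prod>b\<in>(Basis::'a set). (\<integral>\<^sup>+t. ennreal (exp (- a * t\<^sup>2)) \<partial>lborel)) < \<infinity>"
    by (simp add: power_less_top_ennreal)
  also have "(\<Prod>b\<in>(Basis::'a set). (\<integral>\<^sup>+t. ennreal (exp (- a * t\<^sup>2)) \<partial>lborel))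
      = (\<integral>\<^sup>+y. (\<Prod>b\<in>(Basis::'a set). ennreal (exp (- a * (y \<bullet> b)\<^sup>2))) \<partial>lborel)"
    by (subst nn_integral_lborel_prod) auto
  also have "\<dots> = (\<integral>\<^sup>+y. ennreal (exp (- a * (norm (y::'a))\<^sup>2)) \<partial>lborel)"
  proof (intro nn_integral_cong)
    fix y :: 'a
    have "(\<Prod>b\<in>(Basis::'a set). exp (- a * (y \<bullet> b)\<^sup>2)) = exp (- a * (norm y)\<^sup>2)"
      unfolding power2_norm_eq_inner euclidean_inner[of y y]
      by (simp add: exp_sum[symmetric] sum_distrib_left power2_eq_square)
    then show "(\<Prod>b\<in>(Basis::'a set). ennreal (exp (- a * (y \<bullet> b)\<^sup>2)))
        = ennreal (exp (- a * (norm y)\<^sup>2))"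
      by (simp add: prod_ennreal)
  qed
  finally show ?thesis
    by (simp add: integrable_iff_bounded)
qed

lemma integrable_exp_neg_norm_squared_shift:
  fixes p :: "'a::euclidean_space"
  assumes "a > 0"
  shows "integrable lborel (\<lambda>y. exp (- a * (norm (y - p))\<^sup>2))"
  using lborel_integrable_affine[OF integrable_exp_neg_norm_squared[OF assms], of 1 "- p"]
  by simp

lemma integrable_norm_squared_times_gaussian:
  fixes p :: "'a::euclidean_space"
  assumes "a > 0"
  shows "integrable lborel (\<lambda>y. exp (- a * (norm (y - p))\<^sup>2) * (norm (y - p))\<^sup>2)"
proof (rule Bochner_Integration.integrable_bound)
  show "integrable lborel (\<lambda>y. 2 / a * exp (- (a / 2) * (norm (y - p))\<^sup>2))"
    using integrable_exp_neg_norm_squared_shift[of "a / 2" p] assms by simp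
  \<comment> \<open>Half of the Gaussian decay absorbs the factor \<open>u\<close>; the other half
    remains as an integrable majorant.\<close>
  have "exp (- a * u) * u \<le> 2 / a * exp (- (a / 2) * u)" for u :: real
  proof -
    have "u \<le> 2 / a * exp (a / 2 * u)"
      using exp_ge_add_one_self[of "a / 2 * u"] assms by (simp add: field_simps)
    then have "exp (- a * u) * u \<le> exp (- a * u) * (2 / a * exp (a / 2 * u))"
      by (intro mult_left_mono) auto
    also have "\<dots> = 2 / a * exp (- (a / 2) * u)"
      by (simp add: exp_add[symmetric] field_simps)
    finally show ?thesis .
  qed
  then show "AE y in lborel. norm (exp (- a * (norm (y - p))\<^sup>2) * (norm (y - p))\<^sup>2)
      \<le> norm (2 / a * exp (- (a / 2) * (norm (y - p))\<^sup>2))"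
    using assms by (auto simp: abs_mult)
qed auto

section \<open>Moments under a strongly convex potential\<close>

locale strongly_convex_potential =
  fixes U :: "'a::euclidean_space \<Rightarrow> real" and D :: "'a \<Rightarrow> 'a" and \<kappa> :: real and p :: 'a
  assumes kappa_pos: "\<kappa> > 0"
    and gradient: "\<And>y. GDERIV U y :> D y"
    and tangent: "\<And>y z. U y + D y \<bullet> (z - y) + \<kappa> / 2 * (norm (z - y))\<^sup>2 \<le> U z"
    and stationary: "D p = 0"
begin

text \<open>Mass and moments about \<open>p\<close> stay unnormalized: the comparisons below concern
  \<open>exp (- U y)\<close> itself, and division by \<open>Z\<close> occurs only in the final
  quotient.\<close>

definition Z :: real where "Z = (\<integral>y. exp (- U y) \<partial>lborel)"

definition V :: real where "V = (\<integral>y. exp (- U y) * (norm (y - p))\<^sup>2 \<partial>lborel)"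

definition B :: 'a where "B = (\<integral>y. exp (- U y) *\<^sub>R (y - p) \<partial>lborel)"

lemma continuous_potential: "continuous_on S U"
  using gradient unfolding gderiv_def
  by (meson continuous_at_imp_continuous_on has_derivative_continuous)

lemma measurable_potential [measurable]: "U \<in> borel_measurable borel"
  by (intro borel_measurable_continuous_onI continuous_potential)

lemma quadratic_growth: "U p + \<kappa> / 2 * (norm (y - p))\<^sup>2 \<le> U y"
  using tangent[of p y] stationary by simp

text \<open>Gaussian majorant behind the integrability of all moments below.\<close>

lemma exp_neg_potential_le:
  "exp (- U y) \<le> exp (- U p) * exp (- (\<kappa> / 2) * (norm (y - p))\<^sup>2)"
  using quadratic_growth[of y] by (simp add: exp_add[symmetric])

text \<open>Add the tangent inequality from \<open>y\<close> to \<open>z\<close> and the one from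
  \<open>z\<close> to \<open>y\<close>.\<close>

lemma gradient_strongly_monotone: "\<kappa> * (norm (y - z))\<^sup>2 \<le> (D y - D z) \<bullet> (y - z)"
  using tangent[of y z] tangent[of z y]
  by (simp add: norm_minus_commute inner_diff_left inner_diff_right)

lemma integrable_exp_neg_potential: "integrable lborel (\<lambda>y. exp (- U y))"
proof (rule Bochner_Integration.integrable_bound)
  show "integrable lborel (\<lambda>y. exp (- U p) * exp (- (\<kappa> / 2) * (norm (y - p))\<^sup>2))"
    using integrable_exp_neg_norm_squared_shift[of "\<kappa> / 2" p] kappa_pos by simp
qed (use exp_neg_potential_le in auto)

lemma integrable_second_moment:
  "integrable lborel (\<lambda>y. exp (- U y) * (norm (y - p))\<^sup>2)"
proof (rule Bochner_Integration.integrable_bound)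
  show "integrable lborel
      (\<lambda>y. exp (- U p) * (exp (- (\<kappa> / 2) * (norm (y - p))\<^sup>2) * (norm (y - p))\<^sup>2))"
    using integrable_norm_squared_times_gaussian[of "\<kappa> / 2" p] kappa_pos by simp
  show "AE y in lborel. norm (exp (- U y) * (norm (y - p))\<^sup>2)
      \<le> norm (exp (- U p) * (exp (- (\<kappa> / 2) * (norm (y - p))\<^sup>2) * (norm (y - p))\<^sup>2))"
    using mult_right_mono[OF exp_neg_potential_le] by (auto simp: abs_mult mult.assoc)
qed auto

lemma integrable_first_moment: "integrable lborel (\<lambda>y. exp (- U y) *\<^sub>R (y - p))"
proof (rule Bochner_Integration.integrable_bound)
  show "integrable lborel (\<lambda>y. exp (- U y) + exp (- U y) * (norm (y - p))\<^sup>2)"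
    using integrable_exp_neg_potential integrable_second_moment by simp
  \<comment> \<open>From (r - 1/2)^2 >= 0; the zeroth and second moments then dominate the
    first.\<close>
  have "r \<le> 1 + r\<^sup>2" for r :: real
    using zero_le_power2[of "r - 1 / 2"]
    by (simp add: power2_diff power_divide)
  from mult_left_mono[OF this]
  show "AE y in lborel. norm (exp (- U y) *\<^sub>R (y - p))
      \<le> norm (exp (- U y) + exp (- U y) * (norm (y - p))\<^sup>2)"
    by (auto simp: distrib_left)
qed auto

lemma Z_pos: "Z > 0"
proof -
  \<comment> \<open>\<open>exp\<close> never vanishes, so a zero integral would make the whole space
    a null set.\<close>
  have "Z \<noteq> 0"
    unfolding Z_def using integrable_exp_neg_potential
    by (subst integral_nonneg_eq_0_iff_AE) (auto simp: AE_iff_measurable[OF _ refl])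
  moreover have "Z \<ge> 0"
    unfolding Z_def by simp
  ultimately show ?thesis by simp
qed

lemma mean_eq: "(\<integral>y. exp (- U y) *\<^sub>R y \<partial>lborel) = Z *\<^sub>R p + B"
proof -
  have "(\<integral>y. exp (- U y) *\<^sub>R y \<partial>lborel) =
      (\<integral>y. exp (- U y) *\<^sub>R p + exp (- U y) *\<^sub>R (y - p) \<partial>lborel)"
    by (simp add: algebra_simps)
  also have "\<dots> = Z *\<^sub>R p + B"
    unfolding Z_def B_def
    using integrable_exp_neg_potential integrable_first_moment by simp
  finally show ?thesis .
qed

text \<open>The tangent at \<open>p + s *\<^sub>R w\<close> gains (1 - s)^2, and strong monotonicity
  against \<open>p\<close> bounds its linear term below by a gain of 2 s (1 - s), both in units of
  \<open>\<kappa> / 2 * (norm w)\<^sup>2\<close>. They add up to 1 - s^2.\<close>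

lemma scaling_bound:
  assumes "0 < s" "s < 1"
  shows "U (p + s *\<^sub>R w) \<le> U (p + w) - \<kappa> / 2 * (1 - s\<^sup>2) * (norm w)\<^sup>2"
proof -
  have 1: "U (p + s *\<^sub>R w) + (1 - s) * (D (p + s *\<^sub>R w) \<bullet> w) + \<kappa> / 2 * ((1 - s)\<^sup>2 * (norm w)\<^sup>2)
      \<le> U (p + w)"
  proof -
    have "p + w - (p + s *\<^sub>R w) = (1 - s) *\<^sub>R w" by (simp add: algebra_simps)
    then show ?thesis
      using tangent[of "p + s *\<^sub>R w" "p + w"] by (simp add: power_mult_distrib)
  qed
  have "\<kappa> * (s\<^sup>2 * (norm w)\<^sup>2) \<le> s * (D (p + s *\<^sub>R w) \<bullet> w)"
    using gradient_strongly_monotone[of "p + s *\<^sub>R w" p] stationary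
    by (simp add: power_mult_distrib)
  moreover have "\<kappa> * (s\<^sup>2 * (norm w)\<^sup>2) = s * (\<kappa> * (s * (norm w)\<^sup>2))"
    by (simp add: power2_eq_square)
  ultimately have "\<kappa> * (s * (norm w)\<^sup>2) \<le> D (p + s *\<^sub>R w) \<bullet> w"
    using assms by (simp only: mult_le_cancel_left_pos)
  then have "(1 - s) * (\<kappa> * (s * (norm w)\<^sup>2)) \<le> (1 - s) * (D (p + s *\<^sub>R w) \<bullet> w)"
    using assms by (intro mult_left_mono) auto
  with 1 show ?thesis
    by (simp add: field_simps power2_eq_square)
qed

text \<open>Dilation about \<open>p\<close> by \<open>s < 1\<close> raises the integrand by at least
  a multiple of the second moment, while the Jacobian costs \<open>s ^ n\<close>. Comparing the two
  to first order as \<open>s\<close> tends to 1 replaces an integration by parts.\<close>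

lemma second_moment_bound: "\<kappa> * V \<le> real DIM('a) * Z"
proof -
  define n where "n = DIM('a)"
  have step: "s ^ n * (\<kappa> / 2 * (1 + s) * V) \<le> Z * (\<Sum>i<n. s ^ i)" if s: "0 < s" "s < 1" for s
  proof -
    have "Z + \<kappa> / 2 * (1 - s\<^sup>2) * V =
        (\<integral>y. exp (- U y) + \<kappa> / 2 * (1 - s\<^sup>2) * (exp (- U y) * (norm (y - p))\<^sup>2) \<partial>lborel)"
      unfolding Z_def V_def
      using integrable_exp_neg_potential integrable_second_moment by simp
    also have "\<dots> \<le> (\<integral>y. exp (- U ((p - s *\<^sub>R p) + s *\<^sub>R y)) \<partial>lborel)"
    proof (rule integral_mono)
      show "integrable lborel (\<lambda>y. exp (- U ((p - s *\<^sub>R p) + s *\<^sub>R y)))"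
        using lborel_integrable_affine[OF integrable_exp_neg_potential, of s] s by simp
      fix y
      let ?d = "\<kappa> / 2 * (1 - s\<^sup>2) * (norm (y - p))\<^sup>2"
      have "U ((p - s *\<^sub>R p) + s *\<^sub>R y) \<le> U y - ?d"
        using scaling_bound[OF s, of "y - p"] by (simp add: algebra_simps)
      then have "exp (- U y) * exp ?d \<le> exp (- U ((p - s *\<^sub>R p) + s *\<^sub>R y))"
        by (simp add: exp_add[symmetric])
      moreover have "exp (- U y) * (1 + ?d) \<le> exp (- U y) * exp ?d"
        by (intro mult_left_mono exp_ge_add_one_self) auto
      ultimately show "exp (- U y) + \<kappa> / 2 * (1 - s\<^sup>2) * (exp (- U y) * (norm (y - p))\<^sup>2)
          \<le> exp (- U ((p - s *\<^sub>R p) + s *\<^sub>R y))"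
        by (simp add: algebra_simps)
    qed (use integrable_exp_neg_potential integrable_second_moment in auto)
    finally have "s ^ n * (Z + \<kappa> / 2 * (1 - s\<^sup>2) * V) \<le> Z"
      using lborel_integral_affine[of "\<lambda>y. exp (- U y)" s "p - s *\<^sub>R p"] s
      by (simp add: Z_def n_def)
    then have "s ^ n * (\<kappa> / 2 * (1 - s\<^sup>2) * V) \<le> Z * (1 - s ^ n)"
      by (simp add: algebra_simps)
    \<comment> \<open>Both sides carry the factor \<open>1 - s\<close>. Cancelling it before the
      limit leaves a geometric sum of \<open>n\<close> terms, which tends to
      \<open>n\<close>.\<close>
    moreover have "1 - s ^ n = (1 - s) * (\<Sum>i<n. s ^ i)"
      by (rule one_diff_power_eq)
    moreover have "1 - s\<^sup>2 = (1 - s) * (1 + s)"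
      by (simp add: power2_eq_square algebra_simps)
    ultimately have "(1 - s) * (s ^ n * (\<kappa> / 2 * (1 + s) * V)) \<le> (1 - s) * (Z * (\<Sum>i<n. s ^ i))"
      by (simp only: mult_ac)
    then show ?thesis
      using s by simp
  qed
  have "(1::real) ^ n * (\<kappa> / 2 * (1 + 1) * V) \<le> Z * (\<Sum>i<n. 1 ^ i)"
  proof (rule tendsto_le)
    show "((\<lambda>s. Z * (\<Sum>i<n. s ^ i)) \<longlongrightarrow> Z * (\<Sum>i<n. 1 ^ i)) (at_left (1::real))"
      by (intro tendsto_intros)
    show "((\<lambda>s. s ^ n * (\<kappa> / 2 * (1 + s) * V)) \<longlongrightarrow> 1 ^ n * (\<kappa> / 2 * (1 + 1) * V)) (at_left (1::real))"
      by (intro tendsto_intros)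
    have "\<forall>\<^sub>F s in at_left (1::real). s \<in> {0<..<1}"
      by (rule eventually_at_left_real) simp
    then show "\<forall>\<^sub>F s in at_left 1. s ^ n * (\<kappa> / 2 * (1 + s) * V) \<le> Z * (\<Sum>i<n. s ^ i)"
      by eventually_elim (use step in auto)
  qed simp
  then show ?thesis
    by (simp add: n_def mult.commute)
qed

end

section \<open>Potentials with a Lipschitz Hessian\<close>

locale lipschitz_hessian_potential = strongly_convex_potential +
  fixes H :: "'a \<Rightarrow> 'a \<Rightarrow> 'a" and M :: real
  assumes hessian: "\<And>y. (D has_derivative H y) (at y)"
    and lipschitz: "\<And>u v. onorm (\<lambda>h. H u h - H v h) \<le> M * norm (u - v)"
begin

lemma bounded_linear_hessian: "bounded_linear (H y)"
  using hessian has_derivative_bounded_linear by blast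

lemma M_nonneg: "M \<ge> 0"
proof -
  \<comment> \<open>The points \<open>b\<close> and 0 are at distance 1, so the Lipschitz bound
    there is \<open>M\<close> itself.\<close>
  obtain b :: 'a where b: "b \<in> Basis" using nonempty_Basis by blast
  have "0 \<le> onorm (\<lambda>h. H b h - H 0 h)"
    by (intro onorm_pos_le bounded_linear_sub bounded_linear_hessian)
  also have "\<dots> \<le> M * norm (b - 0)"
    by (rule lipschitz)
  finally show ?thesis using b by simp
qed

text \<open>Mean value estimate on the ball of radius \<open>norm w\<close> about \<open>p\<close>,
  where the Hessian differs from \<open>H p\<close> by at most \<open>M * norm w\<close>. The
  constant is \<open>M\<close> rather than the Taylor constant M/2, which the target bound
  allows.\<close>

lemma gradient_linearization: "norm (D (p + w) - H p w) \<le> M * (norm w)\<^sup>2"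
proof -
  have "norm (D (p + w) - D p - H p (p + w - p)) \<le> norm (p + w - p) * (M * norm w)"
  proof (rule differentiable_bound_linearization[where S = "cball p (norm w)" and f' = H])
    show "p + t *\<^sub>R (p + w - p) \<in> cball p (norm w)" if "t \<in> {0..1}" for t
      using that by (simp add: dist_norm mult_left_le_one_le)
    show "(D has_derivative H x) (at x within cball p (norm w))" for x
      using hessian by (rule has_derivative_at_withinI)
    show "onorm (H x - H p) \<le> M * norm w" if "x \<in> cball p (norm w)" for x
    proof -
      have "M * norm (x - p) \<le> M * norm w"
        using that M_nonneg by (intro mult_left_mono) (auto simp: dist_norm norm_minus_commute)
      with lipschitz[of x p] show ?thesis by (simp add: fun_diff_def)
    qed
  qed auto
  then show ?thesis
    by (simp add: stationary power2_eq_square mult_ac)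
qed

text \<open>Strong monotonicity between \<open>p + t *\<^sub>R v\<close> and \<open>p\<close>,
  linearized and divided by t^2; the error is of order \<open>t\<close> and vanishes in the
  limit.\<close>

lemma hessian_coercive: "\<kappa> * (norm v)\<^sup>2 \<le> v \<bullet> H p v"
proof -
  have step: "\<kappa> * (norm v)\<^sup>2 \<le> v \<bullet> H p v + t * (M * norm v ^ 3)" if t: "t > 0" for t
  proof -
    have "\<kappa> * (t\<^sup>2 * (norm v)\<^sup>2) \<le> t * (D (p + t *\<^sub>R v) \<bullet> v)"
      using gradient_strongly_monotone[of "p + t *\<^sub>R v" p] stationary
      by (simp add: power_mult_distrib)
    also have "D (p + t *\<^sub>R v) \<bullet> v = H p (t *\<^sub>R v) \<bullet> v + (D (p + t *\<^sub>R v) - H p (t *\<^sub>R v)) \<bullet> v"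
      by (simp add: inner_diff_left)
    also have "(D (p + t *\<^sub>R v) - H p (t *\<^sub>R v)) \<bullet> v \<le> M * (norm (t *\<^sub>R v))\<^sup>2 * norm v"
      by (rule order_trans[OF norm_cauchy_schwarz mult_right_mono[OF gradient_linearization]]) simp
    also have "H p (t *\<^sub>R v) = t *\<^sub>R H p v"
      by (simp add: linear_cmul bounded_linear.linear bounded_linear_hessian)
    finally have "t\<^sup>2 * (\<kappa> * (norm v)\<^sup>2) \<le> t\<^sup>2 * (v \<bullet> H p v + t * (M * norm v ^ 3))"
      using t by (simp add: power_mult_distrib inner_commute algebra_simps power2_eq_square power3_eq_cube)
    then show ?thesis
      using t by simp
  qed
  have "\<kappa> * (norm v)\<^sup>2 \<le> v \<bullet> H p v + 0 * (M * norm v ^ 3)"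
  proof (rule tendsto_lowerbound)
    show "((\<lambda>t. v \<bullet> H p v + t * (M * norm v ^ 3)) \<longlongrightarrow> v \<bullet> H p v + 0 * (M * norm v ^ 3)) (at_right 0)"
      by (intro tendsto_intros)
    show "\<forall>\<^sub>F t in at_right 0. \<kappa> * (norm v)\<^sup>2 \<le> v \<bullet> H p v + t * (M * norm v ^ 3)"
      using step by (auto simp: eventually_at_right_less intro: eventually_mono[OF eventually_at_right_less])
  qed simp
  then show ?thesis by simp
qed

text \<open>The Hessian is frozen at \<open>p\<close> rather than at \<open>y\<close>, so that the
  linear term integrates to \<open>v \<bullet> H p B\<close>.\<close>

lemma gradient_translation_bound:
  assumes "t > 0"
  shows "D (y + t *\<^sub>R v) \<bullet> v \<le> v \<bullet> H p (y - p) + t * (v \<bullet> H p v)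
      + M * norm v * ((1 + t) * (norm (y - p))\<^sup>2 + (t + t\<^sup>2) * (norm v)\<^sup>2)"
proof -
  define w where "w = y - p + t *\<^sub>R v"
  have pw: "y + t *\<^sub>R v = p + w" by (simp add: w_def)
  have "(norm w)\<^sup>2 \<le> (1 + t) * (norm (y - p))\<^sup>2 + (t + t\<^sup>2) * (norm v)\<^sup>2"
  proof -
    \<comment> \<open>This bounds the cross term so that the coefficient of
      \<open>(norm (y - p))\<^sup>2\<close> tends to 1 with \<open>t\<close> tending to 0, leaving
      exactly \<open>V\<close> in the limit.\<close>
    have "0 \<le> t * (norm (y - p - v))\<^sup>2"
      using assms by simp
    then show ?thesis
      unfolding w_def power2_norm_eq_inner
      by (simp add: inner_commute algebra_simps power2_eq_square)
  qed
  then have *: "M * norm v * (norm w)\<^sup>2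
      \<le> M * norm v * ((1 + t) * (norm (y - p))\<^sup>2 + (t + t\<^sup>2) * (norm v)\<^sup>2)"
    using M_nonneg by (intro mult_left_mono) auto
  have "D (p + w) \<bullet> v = v \<bullet> H p w + (D (p + w) - H p w) \<bullet> v"
    by (simp add: inner_diff_left inner_commute[of v])
  also have "(D (p + w) - H p w) \<bullet> v \<le> M * (norm w)\<^sup>2 * norm v"
    by (rule order_trans[OF norm_cauchy_schwarz mult_right_mono[OF gradient_linearization]]) simp
  also have "M * (norm w)\<^sup>2 * norm v = M * norm v * (norm w)\<^sup>2"
    by simp
  also have "H p w = H p (y - p) + t *\<^sub>R H p v"
    unfolding w_def
    by (simp add: linear_add linear_cmul bounded_linear.linear bounded_linear_hessian)
  finally have "D (p + w) \<bullet> v \<le> v \<bullet> H p (y - p) + t * (v \<bullet> H p v) + M * norm v * (norm w)\<^sup>2"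
    by (simp add: inner_add_right)
  with * show ?thesis
    unfolding pw by linarith
qed

text \<open>The tangent is taken at the translated point and evaluated at \<open>y\<close>: this is
  the direction in which convexity bounds \<open>U\<close> from above there.\<close>

lemma translation_bound:
  assumes "t > 0"
  shows "U (y + t *\<^sub>R v) \<le> U y + t * (v \<bullet> H p (y - p) + t * (v \<bullet> H p v)
      + M * norm v * ((1 + t) * (norm (y - p))\<^sup>2 + (t + t\<^sup>2) * (norm v)\<^sup>2))"
proof -
  have "0 \<le> \<kappa> / 2 * (norm (y - (y + t *\<^sub>R v)))\<^sup>2"
    using kappa_pos by simp
  then have "U (y + t *\<^sub>R v) \<le> U y + t * (D (y + t *\<^sub>R v) \<bullet> v)"
    using tangent[of "y + t *\<^sub>R v" y] by simp
  with mult_left_mono[OF gradient_translation_bound[OF assms, of y v], of t] assms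
  show ?thesis by linarith
qed

text \<open>One-sided form of \<open>E \<langle>v, \<nabla>U(Y)\<rangle> = 0\<close>; the choice \<open>v = - B\<close> below gives the bound on \<open>B\<close>.\<close>

lemma first_moment_variational: "0 \<le> v \<bullet> H p B + M * norm v * V"
proof -
  \<comment> \<open>\<open>Z - t * C t\<close> is the integral of the linearized lower bound for the
    translated density, and \<open>0 \<le> C 0\<close> is the claim.\<close>
  define C where "C t = v \<bullet> H p B + t * (v \<bullet> H p v) * Z
      + M * norm v * ((1 + t) * V + (t + t\<^sup>2) * (norm v)\<^sup>2 * Z)" for t
  have bl: "bounded_linear (\<lambda>w. v \<bullet> H p w)"
    by (intro bounded_linear_compose[OF bounded_linear_inner_right] bounded_linear_hessian)
  have lin: "v \<bullet> H p (exp (- U y) *\<^sub>R (y - p)) = exp (- U y) * (v \<bullet> H p (y - p))" for y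
    by (simp add: linear_cmul bounded_linear.linear bounded_linear_hessian)
  have int1: "integrable lborel (\<lambda>y. exp (- U y) * (v \<bullet> H p (y - p)))"
    and B: "v \<bullet> H p B = (\<integral>y. exp (- U y) * (v \<bullet> H p (y - p)) \<partial>lborel)"
    using integrable_bounded_linear[OF bl integrable_first_moment]
      integral_bounded_linear[OF bl integrable_first_moment]
    by (simp_all add: lin B_def)
  have step: "0 \<le> C t" if t: "t > 0" for t
  proof -
    let ?F = "\<lambda>y. exp (- U y) - t * (exp (- U y) * (v \<bullet> H p (y - p))
        + t * (v \<bullet> H p v) * exp (- U y)
        + M * norm v * ((1 + t) * (exp (- U y) * (norm (y - p))\<^sup>2)
          + (t + t\<^sup>2) * (norm v)\<^sup>2 * exp (- U y)))"
    have "Z - t * C t = (\<integral>y. ?F y \<partial>lborel)"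
      using int1 integrable_exp_neg_potential integrable_second_moment
      by (simp add: C_def B Z_def V_def)
    also have "\<dots> \<le> (\<integral>y. exp (- U (t *\<^sub>R v + 1 *\<^sub>R y)) \<partial>lborel)"
    proof (rule integral_mono)
      show "integrable lborel (\<lambda>y. exp (- U (t *\<^sub>R v + 1 *\<^sub>R y)))"
        using lborel_integrable_affine[OF integrable_exp_neg_potential, of 1] by simp
      show "integrable lborel ?F"
        using int1 integrable_exp_neg_potential integrable_second_moment by simp
      fix y
      let ?d = "t * (v \<bullet> H p (y - p) + t * (v \<bullet> H p v)
        + M * norm v * ((1 + t) * (norm (y - p))\<^sup>2 + (t + t\<^sup>2) * (norm v)\<^sup>2))"
      have "exp (- U y) * (1 + - ?d) \<le> exp (- U y) * exp (- ?d)"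
        by (intro mult_left_mono exp_ge_add_one_self) auto
      also have "\<dots> \<le> exp (- U (t *\<^sub>R v + 1 *\<^sub>R y))"
        using translation_bound[OF t, of y v] by (simp add: exp_add[symmetric] add.commute)
      finally show "?F y \<le> exp (- U (t *\<^sub>R v + 1 *\<^sub>R y))"
        by (simp add: algebra_simps)
    qed
    \<comment> \<open>Translation invariance: hence \<open>Z - t * C t \<le> Z\<close>, and dividing
      by \<open>t > 0\<close> gives the sign of \<open>C t\<close>.\<close>
    also have "\<dots> = Z"
      using lborel_integral_affine[of "\<lambda>y. exp (- U y)" 1 "t *\<^sub>R v"] by (simp add: Z_def)
    finally show ?thesis
      using t by (simp add: zero_le_mult_iff)
  qed
  have "0 \<le> C 0"
  proof (rule tendsto_lowerbound)
    show "(C \<longlongrightarrow> C 0) (at_right 0)"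
      unfolding C_def by (intro tendsto_intros)
    show "\<forall>\<^sub>F t in at_right 0. 0 \<le> C t"
      using step by (auto intro: eventually_mono[OF eventually_at_right_less])
  qed simp
  then show ?thesis
    by (simp add: C_def)
qed

text \<open>The difference is \<open>B /\<^sub>R Z\<close>. Coercivity against the variational
  inequality gives \<open>\<kappa> * norm B \<le> M * V\<close>, and a second factor
  \<open>\<kappa>\<close> turns \<open>V\<close> into a multiple of \<open>Z\<close>.\<close>

theorem norm_mean_diff_le:
  "norm ((\<integral>y. exp (- U y) *\<^sub>R y \<partial>lborel) /\<^sub>R (\<integral>y. exp (- U y) \<partial>lborel) - p)
    \<le> real DIM('a) * M / \<kappa>\<^sup>2"
proof -
  have "\<kappa> * (norm B)\<^sup>2 \<le> M * norm B * V"
  proof -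
    have "H p B \<bullet> B \<ge> \<kappa> * (norm B)\<^sup>2"
      using hessian_coercive[of B] by (simp add: inner_commute)
    then show ?thesis
      using first_moment_variational[of "- B"] by (simp add: inner_commute)
  qed
  \<comment> \<open>Cancel \<open>norm B\<close>; when \<open>B = 0\<close> the right side is
    nonnegative anyway.\<close>
  then have "\<kappa> * norm B \<le> M * V"
    by (cases "B = 0")
      (use M_nonneg in \<open>auto simp: power2_eq_square V_def mult.left_commute[of _ "norm B"]\<close>)
  then have "\<kappa> * (\<kappa> * norm B) \<le> M * (\<kappa> * V)"
    using kappa_pos by (simp add: mult.left_commute)
  also have "\<dots> \<le> M * (real DIM('a) * Z)"
    using M_nonneg second_moment_bound by (rule mult_left_mono[rotated])
  finally have "norm B / Z \<le> real DIM('a) * M / \<kappa>\<^sup>2"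
    using kappa_pos Z_pos by (simp add: field_simps power2_eq_square)
  moreover have "(Z *\<^sub>R p + B) /\<^sub>R Z - p = B /\<^sub>R Z"
    using Z_pos by (simp add: scaleR_add_right)
  ultimately show ?thesis
    using Z_pos by (simp add: mean_eq flip: Z_def) (simp add: divide_inverse mult.commute)
qed

end

section \<open>Tangent inequality, stationary points and gradients\<close>

lemma convex_on_above_tangent_gradient:
  fixes \<phi> :: "'a::real_inner \<Rightarrow> real"
  assumes "convex_on UNIV \<phi>" and "GDERIV \<phi> y :> d"
  shows "\<phi> y + d \<bullet> (z - y) \<le> \<phi> z"
proof -
  \<comment> \<open>Restriction to the line through \<open>y\<close> and \<open>z\<close> reduces
    the claim to the one-variable tangent inequality at 0, evaluated at 1.\<close>
  define \<psi> where "\<psi> t = \<phi> (y + t *\<^sub>R (z - y))" for t :: real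
  have "convex_on UNIV \<psi>"
  proof (rule convex_onI)
    fix t a b :: real
    assume "0 < t" "t < 1"
    have "y + ((1 - t) *\<^sub>R a + t *\<^sub>R b) *\<^sub>R (z - y)
        = (1 - t) *\<^sub>R (y + a *\<^sub>R (z - y)) + t *\<^sub>R (y + b *\<^sub>R (z - y))"
      by (simp add: algebra_simps)
    then show "\<psi> ((1 - t) *\<^sub>R a + t *\<^sub>R b) \<le> (1 - t) * \<psi> a + t * \<psi> b"
      unfolding \<psi>_def using convex_onD[OF assms(1)] \<open>0 < t\<close> \<open>t < 1\<close> by simp
  qed simp
  moreover have "(\<psi> has_field_derivative (d \<bullet> (z - y))) (at 0 within UNIV)"
  proof -
    have "(\<phi> has_derivative (\<lambda>h. h \<bullet> d)) (at (y + 0 *\<^sub>R (z - y)))"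
      using assms(2) by (simp add: gderiv_def)
    moreover have "((\<lambda>t. y + t *\<^sub>R (z - y)) has_derivative (\<lambda>t. t *\<^sub>R (z - y))) (at 0)"
      by (auto intro!: derivative_eq_intros)
    ultimately have "(\<psi> has_derivative (\<lambda>t. t *\<^sub>R (z - y) \<bullet> d)) (at 0)"
      unfolding \<psi>_def by (rule has_derivative_compose[rotated])
    moreover have "(\<lambda>t. t *\<^sub>R (z - y) \<bullet> d) = (*) (d \<bullet> (z - y))"
      by (simp add: fun_eq_iff inner_commute)
    ultimately show ?thesis
      by (simp add: has_field_derivative_def)
  qed
  ultimately have "(d \<bullet> (z - y)) * (1 - 0) \<le> \<psi> 1 - \<psi> 0"
    by (intro convex_on_imp_above_tangent[where A = UNIV]) auto
  then show ?thesis
    by (simp add: \<psi>_def)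
qed

lemma strongly_convex_stationary_point:
  fixes U :: "'a::euclidean_space \<Rightarrow> real"
  assumes "\<kappa> > 0" and gradient: "\<And>y. GDERIV U y :> D y"
    and tangent: "\<And>y z. U y + D y \<bullet> (z - y) + \<kappa> / 2 * (norm (z - y))\<^sup>2 \<le> U z"
  obtains p where "D p = 0"
proof -
  \<comment> \<open>Outside this radius the quadratic term of the tangent bound at 0 outweighs the
    linear one, so \<open>U 0 \<le> U y\<close>. A minimizer over the ball is therefore
    global.\<close>
  define R where "R = 2 * norm (D 0) / \<kappa>"
  have "R \<ge> 0"
    using \<open>\<kappa> > 0\<close> by (simp add: R_def)
  have "continuous_on (cball 0 R) U"
    using gradient unfolding gderiv_def
    by (meson continuous_at_imp_continuous_on has_derivative_continuous)
  then obtain p where p: "p \<in> cball 0 R" "\<And>y. y \<in> cball 0 R \<Longrightarrow> U p \<le> U y"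
    using continuous_attains_inf[of "cball 0 R" U] \<open>R \<ge> 0\<close> by auto
  have "U p \<le> U y" for y
  proof (cases "y \<in> cball 0 R")
    case False
    then have "2 * norm (D 0) \<le> \<kappa> * norm y"
      using \<open>\<kappa> > 0\<close> by (simp add: R_def field_simps)
    then have "norm y * (2 * norm (D 0)) \<le> norm y * (\<kappa> * norm y)"
      by (rule mult_left_mono) simp
    moreover have "- (norm (D 0) * norm y) \<le> D 0 \<bullet> y"
      using Cauchy_Schwarz_ineq2[of "D 0" y] by linarith
    moreover have "U 0 + D 0 \<bullet> y + \<kappa> / 2 * (norm y)\<^sup>2 \<le> U y"
      using tangent[of 0 y] by simp
    ultimately have "U 0 \<le> U y"
      by (simp add: power2_eq_square algebra_simps)
    moreover have "U p \<le> U 0"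
      using p(2)[of 0] \<open>R \<ge> 0\<close> by simp
    ultimately show ?thesis by simp
  qed (use p in simp)
  then have "(\<lambda>h. h \<bullet> D p) = (\<lambda>h. 0)"
    using gradient[of p] unfolding gderiv_def
    by (intro has_derivative_local_min[of U]) auto
  then have "D p \<bullet> D p = 0"
    by metis
  then show thesis
    by (intro that) simp
qed

text \<open>\<open>grad\<close> is a definite description: the gradient exists by representing the
  derivative in the basis, and is unique because the derivative is.\<close>

lemma GDERIV_grad:
  fixes f :: "real ^ 'n \<Rightarrow> real"
  assumes "f differentiable (at y)"
  shows "GDERIV f y :> grad f y"
proof -
  obtain f' where f': "(f has_derivative f') (at y)"
    using assms unfolding differentiable_def by blast
  have "f' = (\<lambda>h. h \<bullet> (\<Sum>b\<in>Basis. f' b *\<^sub>R b))"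
  proof
    fix h
    have "linear f'"
      using f' by (rule has_derivative_linear)
    then have "f' (\<Sum>b\<in>Basis. (h \<bullet> b) *\<^sub>R b) = (\<Sum>b\<in>Basis. (h \<bullet> b) * f' b)"
      by (simp add: linear_sum linear_cmul)
    then show "f' h = h \<bullet> (\<Sum>b\<in>Basis. f' b *\<^sub>R b)"
      by (simp add: euclidean_representation inner_sum_right mult.commute)
  qed
  with f' have "GDERIV f y :> (\<Sum>b\<in>Basis. f' b *\<^sub>R b)"
    unfolding gderiv_def by simp
  moreover have "g = g'" if "GDERIV f y :> g" "GDERIV f y :> g'" for g g'
  proof -
    have "(\<lambda>h. h \<bullet> g) = (\<lambda>h. h \<bullet> g')"
      using that unfolding gderiv_def by (rule has_derivative_unique)
    then have "(g - g') \<bullet> (g - g') = 0"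
      by (metis (no_types) inner_diff_right right_minus_eq)
    then show ?thesis by simp
  qed
  ultimately show ?thesis
    unfolding grad_def by (metis (mono_tags, lifting) theI)
qed

section \<open>Gaussian weights, the Gibbs mean and weak convexity\<close>

lemma prod_normal_density:
  fixes x y :: "real ^ 'n"
  assumes "v > 0"
  shows "(\<Prod>i\<in>UNIV. normal_density (x $ i) (sqrt v) (y $ i))
    = (1 / sqrt (2 * pi * v)) ^ CARD('n) * exp (- (norm (x - y))\<^sup>2 / (2 * v))"
proof -
  have "(norm (x - y))\<^sup>2 = (\<Sum>i\<in>UNIV. (y $ i - x $ i)\<^sup>2)"
    unfolding power2_norm_eq_inner inner_vec_def
    by (intro sum.cong) (simp_all add: power2_eq_square algebra_simps)
  then have "(\<Sum>i\<in>UNIV. - (y $ i - x $ i)\<^sup>2 / (2 * v)) = - (norm (x - y))\<^sup>2 / (2 * v)"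
    by (simp add: sum_negf sum_divide_distrib)
  then show ?thesis
    using assms by (simp add: normal_density_def prod_dividef power_divide exp_sum[symmetric])
qed

text \<open>The Gaussian exponent is the quadratic part of \<open>- U y\<close>, and the normalizing
  constant \<open>c\<close> cancels in the quotient.\<close>

lemma gibbs_mean_eq:
  fixes f :: "real ^ 'n \<Rightarrow> real" and x :: "real ^ 'n"
  assumes [measurable]: "f \<in> borel_measurable borel" and "lam > 0" and "\<delta> > 0"
  defines "U \<equiv> \<lambda>y. (f y + 1 / (2 * lam) * (norm (x - y))\<^sup>2) / \<delta>"
  shows "gibbs_mean lam f \<delta> x
    = (\<integral>y. exp (- U y) *\<^sub>R y \<partial>lborel) /\<^sub>R (\<integral>y. exp (- U y) \<partial>lborel)"
proof -
  define c where "c = (1 / sqrt (2 * pi * (\<delta> * lam))) ^ CARD('n)"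
  have "c > 0"
    using assms by (simp add: c_def)
  define q where "q y = (\<Prod>i\<in>UNIV. normal_density (x $ i) (sqrt (\<delta> * lam)) (y $ i))" for y
  have q: "q y = c * exp (- (norm (x - y))\<^sup>2 / (2 * (\<delta> * lam)))" for y
    unfolding q_def c_def using assms by (intro prod_normal_density) simp
  have weight: "q y * exp (- f y / \<delta>) = c * exp (- U y)" for y
    using assms by (simp add: q U_def exp_add[symmetric] field_simps)
  then have weight_scaleR: "q y *\<^sub>R exp (- f y / \<delta>) *\<^sub>R y = c *\<^sub>R exp (- U y) *\<^sub>R y" for y
    by (simp only: scaleR_scaleR)
  have [measurable]: "q \<in> borel_measurable borel"
    unfolding q by measurable
  have "(\<integral>y. exp (- f y / \<delta>) *\<^sub>R y \<partial>gaussian x (\<delta> * lam)) = c *\<^sub>R (\<integral>y. exp (- U y) *\<^sub>R y \<partial>lborel)"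
    unfolding gaussian_def q_def[symmetric]
    using \<open>c > 0\<close> by (subst integral_density) (simp_all only: weight_scaleR integral_scaleR_right, auto simp: q)
  moreover have "(\<integral>y. exp (- f y / \<delta>) \<partial>gaussian x (\<delta> * lam)) = c * (\<integral>y. exp (- U y) \<partial>lborel)"
    unfolding gaussian_def q_def[symmetric]
    using \<open>c > 0\<close> by (subst integral_density) (simp_all only: weight real_scaleR_def, auto simp: q)
  ultimately show ?thesis
    using \<open>c > 0\<close> by (simp add: gibbs_mean_def)
qed

text \<open>Tangent inequality for the convexified function, whose gradient is
  \<open>d + \<rho> *\<^sub>R y\<close>; the squares recombine into
  \<open>(norm (z - y))\<^sup>2\<close>.\<close>

lemma weakly_convex_tangent:
  fixes f :: "real ^ 'n \<Rightarrow> real"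
  assumes "weakly_convex \<rho> f" and "GDERIV f y :> d"
  shows "f y + d \<bullet> (z - y) - \<rho> / 2 * (norm (z - y))\<^sup>2 \<le> f z"
proof -
  have "GDERIV (\<lambda>y. f y + \<rho> / 2 * (norm y)\<^sup>2) y :> d + \<rho> *\<^sub>R y"
    using assms(2) unfolding gderiv_def power2_norm_eq_inner
    by (auto intro!: derivative_eq_intros simp: inner_add_right inner_commute)
  from convex_on_above_tangent_gradient[OF assms(1)[unfolded weakly_convex_def] this, of z]
  show ?thesis
    unfolding power2_norm_eq_inner by (simp add: inner_commute algebra_simps)
qed

section \<open>The proximal point as stationary point, and the estimate for
  \<open>gibbs_mean\<close>\<close>

theorem theorem4p1:
  fixes f :: "real ^ 'n \<Rightarrow> real" and x :: "real ^ 'n" and \<rho> L lam \<mu> \<delta> :: real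
  assumes "twice_cont_diff f"
    and "\<rho> \<ge> 0" and "weakly_convex \<rho> f"
    and "L \<ge> 0"
    and "\<And>u v. op_norm (hessian f u - hessian f v) \<le> L * norm (u - v)"
    and "0 < lam" and "\<rho> > 0 \<Longrightarrow> lam < 1 / \<rho>"
    and "\<mu> = 1 / lam - \<rho>"
    and "\<delta> > 0"
  shows "norm (gibbs_mean lam f \<delta> x - prox lam f x) \<le> real CARD('n) * L / \<mu>\<^sup>2 * \<delta>"
proof -
  \<comment> \<open>The case \<open>\<rho> = 0\<close> is the convention that 1/0 is infinite; then
    \<open>\<mu> = 1 / lam\<close>.\<close>
  have "\<mu> > 0"
    using assms(2,6,7,8) by (cases "\<rho> = 0") (auto simp: less_divide_eq mult.commute)
  have grad_f: "GDERIV f y :> grad f y" for y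
    using assms(1) by (intro GDERIV_grad) (auto simp: twice_cont_diff_def differentiable_on_def)
  have hess_f: "(grad f has_derivative (\<lambda>h. hessian f y *v h)) (at y)" for y
    using assms(1) unfolding hessian_def
    by (intro iffD1[OF jacobian_works]) (auto simp: twice_cont_diff_def differentiable_on_def)
  have "f \<in> borel_measurable borel"
    using assms(1) unfolding twice_cont_diff_def
    by (intro borel_measurable_continuous_onI differentiable_imp_continuous_on) simp
  define g where "g y = f y + 1 / (2 * lam) * (norm (x - y))\<^sup>2" for y
  define U where "U y = g y / \<delta>" for y
  define D where "D y = (grad f y + (y - x) /\<^sub>R lam) /\<^sub>R \<delta>" for y
  define H where "H y h = (hessian f y *v h + h /\<^sub>R lam) /\<^sub>R \<delta>" for y h
  have gradient: "GDERIV U y :> D y" for y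
    using grad_f[of y] assms(6,9) unfolding gderiv_def U_def g_def D_def power2_norm_eq_inner
    by (auto intro!: derivative_eq_intros simp: inner_commute algebra_simps divide_simps)
  \<comment> \<open>The proximal term expands exactly with curvature \<open>1 / lam\<close>, and
    weak convexity loses \<open>\<rho>\<close>; the net modulus is \<open>\<mu>\<close>, rescaled by
    \<open>\<delta>\<close>.\<close>
  have tangent: "U y + D y \<bullet> (z - y) + \<mu> / \<delta> / 2 * (norm (z - y))\<^sup>2 \<le> U z" for y z
  proof -
    have "g y + (grad f y + (y - x) /\<^sub>R lam) \<bullet> (z - y) + \<mu> / 2 * (norm (z - y))\<^sup>2 \<le> g z"
    proof -
      have "(norm (x - z))\<^sup>2 = (norm (x - y))\<^sup>2 + 2 * ((y - x) \<bullet> (z - y)) + (norm (z - y))\<^sup>2"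
        unfolding power2_norm_eq_inner by (simp add: inner_commute algebra_simps)
      moreover have "1 / (2 * lam) * (2 * ((y - x) \<bullet> (z - y))) = ((y - x) /\<^sub>R lam) \<bullet> (z - y)"
        by (simp add: inverse_eq_divide)
      ultimately have "g z = f z + 1 / (2 * lam) * (norm (x - y))\<^sup>2 + ((y - x) /\<^sub>R lam) \<bullet> (z - y)
          + 1 / (2 * lam) * (norm (z - y))\<^sup>2"
        by (simp add: g_def distrib_left)
      moreover have "\<mu> / 2 * (norm (z - y))\<^sup>2
          = 1 / (2 * lam) * (norm (z - y))\<^sup>2 - \<rho> / 2 * (norm (z - y))\<^sup>2"
        using assms(6) by (simp add: assms(8) field_simps)
      ultimately show ?thesis
        using weakly_convex_tangent[OF assms(3) grad_f[of y], of z]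
        unfolding inner_add_left g_def[of y] by linarith
    qed
    from divide_right_mono[OF this, of \<delta>]
    have "g y / \<delta> + (grad f y + (y - x) /\<^sub>R lam) \<bullet> (z - y) / \<delta> + \<mu> / 2 * (norm (z - y))\<^sup>2 / \<delta>
        \<le> g z / \<delta>"
      using assms(9) by (simp only: add_divide_distrib)
    moreover have "D y \<bullet> (z - y) = (grad f y + (y - x) /\<^sub>R lam) \<bullet> (z - y) / \<delta>"
      unfolding D_def inner_scaleR_left by (simp only: divide_inverse_commute)
    ultimately show ?thesis
      by (simp add: U_def mult.commute)
  qed
  obtain p where "D p = 0"
    using strongly_convex_stationary_point[OF _ gradient tangent] \<open>\<mu> > 0\<close> assms(9) by auto
  interpret lipschitz_hessian_potential U D "\<mu> / \<delta>" p H "L / \<delta>"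
  proof
    show "(D has_derivative H y) (at y)" for y
      unfolding D_def H_def by (auto intro!: derivative_eq_intros hess_f)
    show "onorm (\<lambda>h. H u h - H v h) \<le> L / \<delta> * norm (u - v)" for u v
    proof -
      \<comment> \<open>The constant Hessian of the proximal term cancels, so only the Hessian of
        \<open>f\<close> enters the Lipschitz bound.\<close>
      have "(\<lambda>h. H u h - H v h) = (\<lambda>h. inverse \<delta> *\<^sub>R ((hessian f u - hessian f v) *v h))"
        by (simp add: H_def matrix_vector_mult_diff_rdistrib flip: scaleR_diff_right)
      then have "onorm (\<lambda>h. H u h - H v h) = inverse \<delta> * op_norm (hessian f u - hessian f v)"
        using assms(9) by (simp add: onorm_scaleR op_norm_def)
      also have "\<dots> \<le> inverse \<delta> * (L * norm (u - v))"
        using assms(5,9) by (intro mult_left_mono) auto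
      finally show ?thesis
        by (simp add: divide_inverse mult_ac)
    qed
  qed (use \<open>\<mu> > 0\<close> \<open>D p = 0\<close> assms(9) gradient tangent in auto)
  have minimum: "g p + \<mu> / 2 * (norm (y - p))\<^sup>2 \<le> g y" for y
    using mult_left_mono[OF quadratic_growth[of y], of \<delta>] assms(9)
    by (simp add: U_def distrib_left)
  \<comment> \<open>Quadratic growth about \<open>p\<close> gives both the existence and the
    uniqueness that the definite description requires.\<close>
  have "prox lam f x = p"
    unfolding prox_def g_def[symmetric]
  proof (rule the_equality)
    show "is_arg_min g (\<lambda>_. True) p"
      using minimum \<open>\<mu> > 0\<close> unfolding is_arg_min_def
      by (smt (verit) mult_nonneg_nonneg zero_le_power2 half_gt_zero)
    show "q = p" if "is_arg_min g (\<lambda>_. True) q" for q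
    proof -
      have "g q \<le> g p"
        using that by (auto simp: is_arg_min_def not_less)
      with minimum[of q] have "\<mu> / 2 * (norm (q - p))\<^sup>2 \<le> 0"
        by simp
      then show ?thesis
        using \<open>\<mu> > 0\<close> by (simp add: mult_le_0_iff)
    qed
  qed
  moreover have "gibbs_mean lam f \<delta> x
      = (\<integral>y. exp (- U y) *\<^sub>R y \<partial>lborel) /\<^sub>R (\<integral>y. exp (- U y) \<partial>lborel)"
    using gibbs_mean_eq[OF \<open>f \<in> borel_measurable borel\<close> assms(6,9)] by (simp add: U_def g_def)
  \<comment> \<open>One division by \<open>\<delta>\<close> above against two below leaves the
    factor \<open>\<delta>\<close>.\<close>
  moreover have "real CARD('n) * (L / \<delta>) / (\<mu> / \<delta>)\<^sup>2 = real CARD('n) * L / \<mu>\<^sup>2 * \<delta>"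
    using assms(9) \<open>\<mu> > 0\<close> by (simp add: field_simps power2_eq_square)
  ultimately show ?thesis
    using norm_mean_diff_le by simp
qed

end
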